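(* Let $0\le\varepsilon\le\arccos\sqrt{2/3}$ and put $f(\varepsilon)=\tfrac12\left(1+\cos\varepsilon-\sqrt2\,\sin\varepsilon\right)$. For every single-qubit state $\tau$ (pure or mixed) and every triple of unit vectors $\hat n_1,\hat n_2,\hat n_3\in\mathbb{R}^3$ with $\hat n_k\cdot \hat e_k\ge\cos\varepsilon$ for $k=1,2,3$ (where $\hat e_1,\hat e_2,\hat e_3$ is the standard basis of $\mathbb{R}^3$), the state $\rho$ reconstructed from the data generated by measuring $\hat n_k\cdot\vec\sigma$ on $\tau$ while presuming that $\sigma_x,\sigma_y,\sigma_z$ were measured (as defined in the context) satisfies $$\mathcal F(\tau,\rho)\ \ge\ f(\varepsilon).$$ Moreover $f(\varepsilon)$ is the minimal (worst-case) fidelity: there are a pure state $\tau$ and directions $\hat n_k$ with $\hat n_k\cdot\hat e_k\ge\cos\varepsilon$ for which $\mathcal F(\tau,\rho)=f(\varepsilon)$.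
   Context: $\vec\sigma=(\sigma_x,\sigma_y,\sigma_z)$ is the vector of Pauli matrices. A single-qubit state is a $2\times2$ density matrix $\tau=\frac12(\mathbb 1+\vec t\cdot\vec\sigma)$ with Bloch vector $\vec t\in\mathbb{R}^3$, $\|\vec t\|\le1$. The fidelity is $\mathcal F(\tau,\rho)=\left(\mathrm{tr}\sqrt{\sqrt\tau\,\rho\,\sqrt\tau}\right)^2$. Data: the observables intended to be measured are $M_1=\sigma_x$, $M_2=\sigma_y$, $M_3=\sigma_z$, but those actually measured are $N_k=\hat n_k\cdot\vec\sigma$. There is no statistical error, so the data are the exact probabilities $P(\pm1|k)=\mathrm{tr}\left(\tau\,\frac{\mathbb 1\pm N_k}{2}\right)$, $k=1,2,3$. Let $\vec c\in\mathbb{R}^3$ be the vector with components $c_k=P(+1|k)-P(-1|k)=\hat n_k\cdot\vec t$. Reconstruction (linear inversion when possible, otherwise maximum-likelihood estimation): if $\|\vec c\|\le1$, then $\rho=\frac12(\mathbb 1+\vec c\cdot\vec\sigma)$. If $\|\vec c\|>1$, then $\rho=\frac12(\mathbb 1+\vec r\cdot\vec\sigma)$, where $\vec r$ maximizes, over all $\vec r\in\mathbb{R}^3$ with $\|\vec r\|\le1$, the log-likelihood $$\log\mathcal L(\vec r)=\sum_{k=1}^3\sum_{a=\pm1}P(a|k)\,\log\frac{1+a\,r_k}{2},$$ with the conventions $0\log0=0$ and $\log 0=-\infty$. *)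

theory Defs
  imports "HOL-Analysis.Analysis"
begin

section \<open>Complex matrices\<close>

definition dagger :: "complex^'n^'n \<Rightarrow> complex^'n^'n" where
  "dagger A = (\<chi> i j. cnj (A $ j $ i))"

definition psd :: "complex^'n^'n \<Rightarrow> bool" where
  "psd A \<longleftrightarrow> dagger A = A \<and> (\<forall>v. 0 \<le> Re (\<Sum>i\<in>UNIV. cnj (v $ i) * (A *v v) $ i))"

text \<open>The square root of a positive semidefinite matrix; only meaningful if the argument is
  positive semidefinite.\<close>

definition msqrt :: "complex^'n^'n \<Rightarrow> complex^'n^'n" where
  "msqrt A = (THE S. psd S \<and> S ** S = A)"

text \<open>For positive semidefinite arguments the trace below is a nonnegative real.\<close>

definition fidelity :: "complex^'n^'n \<Rightarrow> complex^'n^'n \<Rightarrow> real" where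
  "fidelity \<tau> \<rho> = (Re (trace (msqrt (msqrt \<tau> ** \<rho> ** msqrt \<tau>))))\<^sup>2"


section \<open>Single-qubit states\<close>

definition pauli :: "(complex^2^2)^3" where
  "pauli = vector [vector [vector [0, 1], vector [1, 0]],
                   vector [vector [0, - \<i>], vector [\<i>, 0]],
                   vector [vector [1, 0], vector [0, -1]]]"

definition dot_pauli :: "real^3 \<Rightarrow> complex^2^2" where
  "dot_pauli v = (\<Sum>k\<in>UNIV. (v $ k) *\<^sub>R (pauli $ k))"

definition bloch_matrix :: "real^3 \<Rightarrow> complex^2^2" where
  "bloch_matrix t = (1/2) *\<^sub>R (mat 1 + dot_pauli t)"

definition qubit_state :: "complex^2^2 \<Rightarrow> bool" where
  "qubit_state \<tau> \<longleftrightarrow> psd \<tau> \<and> trace \<tau> = 1"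

definition pure_state :: "complex^2^2 \<Rightarrow> bool" where
  "pure_state \<tau> \<longleftrightarrow>
     qubit_state \<tau> \<and> (\<exists>\<psi>. norm \<psi> = 1 \<and> \<tau> = (\<chi> i j. \<psi> $ i * cnj (\<psi> $ j)))"


section \<open>Measurement data and reconstruction\<close>

text \<open>Data are given as a function \<open>P a k\<close>, the probability of the outcome \<open>a \<in> {1, -1}\<close>
  of the \<open>k\<close>-th measurement.  The trace in the Born rule is real for Hermitian \<open>\<tau>\<close>.\<close>

definition born_data :: "complex^2^2 \<Rightarrow> (3 \<Rightarrow> real^3) \<Rightarrow> real \<Rightarrow> 3 \<Rightarrow> real" where
  "born_data \<tau> n a k = Re (trace (\<tau> ** ((1/2) *\<^sub>R (mat 1 + a *\<^sub>R dot_pauli (n k)))))"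

definition correlations :: "(real \<Rightarrow> 3 \<Rightarrow> real) \<Rightarrow> real^3" where
  "correlations P = (\<chi> k. P 1 k - P (-1) k)"

text \<open>The logarithm on the nonnegative reals with \<open>log 0 = -\<infinity>\<close>.  The convention
  \<open>0 log 0 = 0\<close> is built into multiplication on \<^typ>\<open>ereal\<close>.\<close>

definition elog :: "real \<Rightarrow> ereal" where
  "elog x = (if x > 0 then ereal (ln x) else -\<infinity>)"

definition log_likelihood :: "(real \<Rightarrow> 3 \<Rightarrow> real) \<Rightarrow> real^3 \<Rightarrow> ereal" where
  "log_likelihood P r = (\<Sum>k\<in>UNIV. \<Sum>a\<in>{1, -1}. ereal (P a k) * elog ((1 + a * r $ k) / 2))"

definition reconstruction :: "(real \<Rightarrow> 3 \<Rightarrow> real) \<Rightarrow> complex^2^2" where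
  "reconstruction P =
     (if norm (correlations P) \<le> 1 then bloch_matrix (correlations P)
      else bloch_matrix (arg_max_on (log_likelihood P) {r. norm r \<le> 1}))"

definition directions_within :: "real \<Rightarrow> (3 \<Rightarrow> real^3) \<Rightarrow> bool" where
  "directions_within \<epsilon> n \<longleftrightarrow> (\<forall>k. norm (n k) = 1 \<and> n k \<bullet> axis k 1 \<ge> cos \<epsilon>)"


section \<open>Bloch-vector form of states and data\<close>

lemma bloch_matrix_components:
  "bloch_matrix t $ 1 $ 1 = Complex ((1 + t $ 3) / 2) 0"
  "bloch_matrix t $ 1 $ 2 = Complex (t $ 1 / 2) (- t $ 2 / 2)"
  "bloch_matrix t $ 2 $ 1 = Complex (t $ 1 / 2) (t $ 2 / 2)"
  "bloch_matrix t $ 2 $ 2 = Complex ((1 - t $ 3) / 2) 0"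
  by (simp_all add: bloch_matrix_def dot_pauli_def pauli_def sum_3 mat_def complex_eq_iff)

lemma qubit_state_iff_bloch:
  "qubit_state \<tau> \<longleftrightarrow> (\<exists>t. norm t \<le> 1 \<and> \<tau> = bloch_matrix t)"
proof
  assume s: "qubit_state \<tau>"
  then have h: "dagger \<tau> = \<tau>" and tr: "\<tau> $ 1 $ 1 + \<tau> $ 2 $ 2 = 1"
    and p: "\<And>v. 0 \<le> Re (\<Sum>i\<in>UNIV. cnj (v $ i) * (\<tau> *v v) $ i)"
    by (auto simp: qubit_state_def psd_def trace_def sum_2)
  have h': "cnj (\<tau> $ j $ i) = \<tau> $ i $ j" for i j
    using arg_cong[OF h, of "\<lambda>A. A $ i $ j"] by (simp add: dagger_def)
  define t :: "real^3" where
    "t = vector [2 * Re (\<tau> $ 1 $ 2), - 2 * Im (\<tau> $ 1 $ 2), Re (\<tau> $ 1 $ 1) - Re (\<tau> $ 2 $ 2)]"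
  have e: "\<tau> = bloch_matrix t"
    using h'[of 1 1] h'[of 2 2] h'[of 1 2] tr
    by (simp add: vec_eq_iff forall_2 bloch_matrix_components complex_eq_iff t_def)
  have "0 \<le> 1 - ((t $ 1)\<^sup>2 + (t $ 2)\<^sup>2 + (t $ 3)\<^sup>2)"
    using p[of "vector [- (\<tau> $ 1 $ 2), \<tau> $ 1 $ 1]"] p[of "vector [\<tau> $ 2 $ 2, - (\<tau> $ 2 $ 1)]"]
    unfolding e
    by (simp add: sum_2 matrix_vector_mult_def bloch_matrix_components)
       (simp add: field_simps power2_eq_square)
  then have "norm t \<le> 1"
    by (simp add: norm_vec_def L2_set_def sum_3 real_sqrt_le_1_iff)
  with e show "\<exists>t. norm t \<le> 1 \<and> \<tau> = bloch_matrix t" by blast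
next
  assume "\<exists>t. norm t \<le> 1 \<and> \<tau> = bloch_matrix t"
  then obtain t where t: "norm t \<le> 1" and e: "\<tau> = bloch_matrix t" by blast
  define x y z where xyz: "x = t $ 1" "y = t $ 2" "z = t $ 3"
  have d: "0 \<le> 1 - (x\<^sup>2 + y\<^sup>2 + z\<^sup>2)"
    using t by (simp add: norm_vec_def L2_set_def sum_3 real_sqrt_le_1_iff xyz)
  have "0 \<le> Re (\<Sum>i\<in>UNIV. cnj (v $ i) * (\<tau> *v v) $ i)" for v
  proof -
    define a b c w where v: "a = Re (v $ 1)" "b = Im (v $ 1)" "c = Re (v $ 2)" "w = Im (v $ 2)"
    have "4 * Re (\<Sum>i\<in>UNIV. cnj (v $ i) * (\<tau> *v v) $ i)
        = ((1 + z) * a + x * c + y * w)\<^sup>2 + ((1 + z) * b + x * w - y * c)\<^sup>2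
        + (x * a - y * b + (1 - z) * c)\<^sup>2 + (x * b + y * a + (1 - z) * w)\<^sup>2
        + (1 - (x\<^sup>2 + y\<^sup>2 + z\<^sup>2)) * (a\<^sup>2 + b\<^sup>2 + c\<^sup>2 + w\<^sup>2)"
      unfolding e
      by (simp add: sum_2 matrix_vector_mult_def bloch_matrix_components flip: v xyz)
         (simp add: field_simps power2_eq_square)
    also have "\<dots> \<ge> 0"
      using d by (intro add_nonneg_nonneg mult_nonneg_nonneg) auto
    finally show ?thesis by simp
  qed
  then show "qubit_state \<tau>"
    unfolding qubit_state_def psd_def
    by (simp add: e trace_def sum_2 dagger_def vec_eq_iff forall_2 bloch_matrix_components
        complex_eq_iff field_simps)
qed

lemma correlations_born_data:
  "correlations (born_data (bloch_matrix t) n) = (\<chi> k. n k \<bullet> t)"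
  by (simp add: vec_eq_iff correlations_def born_data_def trace_def sum_2 sum_3 matrix_matrix_mult_def
      bloch_matrix_components inner_vec_def dot_pauli_def pauli_def mat_def)
     (simp add: field_simps)

end

theory Submission
  imports Defs
begin

text \<open>In terms of Bloch vectors the fidelity is \<open>(1 + t \<bullet> r + \<surd>((1 - |t|\<^sup>2) (1 - |r|\<^sup>2))) / 2\<close>, so
  the task is to bound \<open>t \<bullet> r\<close> from below by \<open>g = cos \<epsilon> - \<surd>2 sin \<epsilon>\<close>, up to the square root.
  Since \<open>n\<^sub>k\<close> and \<open>e\<^sub>k\<close> enclose an angle of at most \<open>\<epsilon>\<close>, each of \<open>t\<^sub>k = e\<^sub>k \<bullet> t\<close> and \<open>c\<^sub>k = n\<^sub>k \<bullet> t\<close>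
  bounds the other: if \<open>x\<close> is one and \<open>y\<close> the other, \<open>x y \<ge> x\<^sup>2 cos \<epsilon> - |x| \<surd>(|t|\<^sup>2 - x\<^sup>2) sin \<epsilon>\<close>.
  Summing over \<open>k\<close> with AM-GM gives \<open>g\<close>.  If \<open>|c| > 1\<close>, a maximizer \<open>r\<close> of the likelihood lies on
  the unit sphere with every \<open>r\<^sub>k\<close> between \<open>0\<close> and \<open>c\<^sub>k\<close>, because the likelihood of each coordinate
  increases strictly towards \<open>c\<^sub>k\<close>; no further information about \<open>r\<close> is needed, since the bound on
  \<open>|t\<^sub>k|\<close> is monotone in \<open>|c\<^sub>k|\<close>.\<close>

section \<open>The qubit fidelity in Bloch form\<close>

text \<open>Coordinates for all Hermitian 2 x 2 matrices, not only those of trace 1, since square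
  roots of states occur as well. The eigenvalues of \<open>herm p v\<close> are p + |v| and p -
  |v|.\<close>

definition herm :: "real \<Rightarrow> real^3 \<Rightarrow> complex^2^2" where
  "herm p v = p *\<^sub>R mat 1 + dot_pauli v"

lemma herm_components:
  "herm p v $ 1 $ 1 = Complex (p + v $ 3) 0"
  "herm p v $ 1 $ 2 = Complex (v $ 1) (- v $ 2)"
  "herm p v $ 2 $ 1 = Complex (v $ 1) (v $ 2)"
  "herm p v $ 2 $ 2 = Complex (p - v $ 3) 0"
  by (simp_all add: herm_def dot_pauli_def pauli_def sum_3 mat_def complex_eq_iff)

lemma bloch_matrix_eq_herm: "bloch_matrix t = herm (1/2) ((1/2) *\<^sub>R t)"
  by (simp add: vec_eq_iff forall_2 bloch_matrix_components herm_components complex_eq_iff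
      field_simps)

lemma norm_power2_3: "(norm (v::real^3))\<^sup>2 = (v $ 1)\<^sup>2 + (v $ 2)\<^sup>2 + (v $ 3)\<^sup>2"
  by (simp add: norm_vec_def L2_set_def sum_3)

lemma dagger_herm [simp]: "dagger (herm p v) = herm p v"
  by (simp add: dagger_def vec_eq_iff forall_2 herm_components complex_eq_iff)

lemma hermitian_imp_herm:
  assumes "dagger A = A"
  obtains p v where "A = herm p v"
proof
  have h: "cnj (A $ j $ i) = A $ i $ j" for i j
    using arg_cong[OF assms, of "\<lambda>A. A $ i $ j"] by (simp add: dagger_def)
  show "A = herm ((Re (A $ 1 $ 1) + Re (A $ 2 $ 2)) / 2)
      (vector [Re (A $ 1 $ 2), - Im (A $ 1 $ 2), (Re (A $ 1 $ 1) - Re (A $ 2 $ 2)) / 2])"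
    using h[of 1 1] h[of 2 2] h[of 1 2]
    by (simp add: vec_eq_iff forall_2 herm_components complex_eq_iff field_simps)
qed

lemma trace_herm: "trace (herm p v) = of_real (2 * p)"
  by (simp add: trace_def sum_2 herm_components complex_eq_iff)

lemma det_herm: "det (herm p v) = of_real (p\<^sup>2 - (norm v)\<^sup>2)"
  by (simp add: det_2 herm_components complex_eq_iff norm_power2_3)
     (simp add: power2_eq_square algebra_simps)

lemma herm_square: "herm p v ** herm p v = herm (p\<^sup>2 + (norm v)\<^sup>2) ((2 * p) *\<^sub>R v)"
  by (simp add: vec_eq_iff forall_2 matrix_matrix_mult_def sum_2 herm_components complex_eq_iff
      norm_power2_3)
     (simp add: power2_eq_square algebra_simps)

lemma trace_herm_mult: "trace (herm p v ** herm q w) = of_real (2 * (p * q + v \<bullet> w))"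
  by (simp add: trace_def matrix_matrix_mult_def sum_2 herm_components complex_eq_iff
      inner_vec_def sum_3)
     (simp add: algebra_simps)

lemma herm_inject: "herm p v = herm q w \<longleftrightarrow> p = q \<and> v = w"
  by (auto simp: vec_eq_iff forall_2 forall_3 herm_components complex_eq_iff)

text \<open>The smaller eigenvalue is p - |v|. For p > 0, division by the trace 2p reduces the claim
  to the Bloch ball description of states; otherwise test vectors leave only the zero
  matrix.\<close>

lemma psd_herm_iff: "psd (herm p v) \<longleftrightarrow> norm v \<le> p"
proof (cases "p > 0")
  case True
  have e: "herm p v = (2 * p) *\<^sub>R bloch_matrix ((1/p) *\<^sub>R v)"
    using True by (simp add: bloch_matrix_def herm_def dot_pauli_def sum_3 algebra_simps)
  have s: "psd (c *\<^sub>R A)" if "psd A" "c \<ge> 0" for c and A :: "complex^2^2"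
  proof -
    have "(\<Sum>i\<in>UNIV. cnj (w $ i) * ((c *\<^sub>R A) *v w) $ i)
        = c *\<^sub>R (\<Sum>i\<in>UNIV. cnj (w $ i) * (A *v w) $ i)" for w
      by (simp add: sum_2 matrix_vector_mult_def algebra_simps)
    moreover have "dagger (c *\<^sub>R A) = c *\<^sub>R dagger A"
      by (simp add: dagger_def vec_eq_iff)
    ultimately show ?thesis using that by (simp add: psd_def)
  qed
  let ?B = "bloch_matrix ((1/p) *\<^sub>R v)"
  have "psd (herm p v) \<longleftrightarrow> psd ?B"
  proof
    assume "psd (herm p v)"
    from s[OF this, of "1 / (2*p)"] show "psd ?B" using True by (simp add: e)
  qed (use s[of ?B "2*p"] True e in simp)
  also have "\<dots> \<longleftrightarrow> qubit_state ?B"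
    by (simp add: qubit_state_def bloch_matrix_eq_herm trace_herm)
  also have "\<dots> \<longleftrightarrow> norm ((1/p) *\<^sub>R v) \<le> 1"
  proof -
    have "bloch_matrix s = bloch_matrix t \<longleftrightarrow> s = t" for s t
      by (auto simp: bloch_matrix_eq_herm herm_inject)
    then show ?thesis unfolding qubit_state_iff_bloch by auto
  qed
  also have "\<dots> \<longleftrightarrow> norm v \<le> p"
    using True by (simp add: field_simps)
  finally show ?thesis .
next
  case False
  show ?thesis
  proof
    assume P: "psd (herm p v)"
    then have q: "0 \<le> Re (\<Sum>i\<in>UNIV. cnj (w $ i) * (herm p v *v w) $ i)" for w
      by (simp add: psd_def)
    have "v $ 3 = 0" "p = 0"
      \<comment> \<open>The basis vectors give p + v3 >= 0 and p - v3 >= 0, and p <= 0 makes both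
        zero. With a zero diagonal, the four further test vectors bound each off-diagonal part from
        both sides.\<close>
      using q[of "vector [1, 0]"] q[of "vector [0, 1]"] False
      by (simp_all add: sum_2 matrix_vector_mult_def herm_components)
    then have "v $ 1 = 0" "v $ 2 = 0"
      using q[of "vector [1, 1]"] q[of "vector [1, -1]"] q[of "vector [1, \<i>]"] q[of "vector [1, -\<i>]"]
      by (simp_all add: sum_2 matrix_vector_mult_def herm_components)
    with \<open>v $ 3 = 0\<close> \<open>p = 0\<close> show "norm v \<le> p"
      by (simp add: vec_eq_iff forall_3)
  next
    assume "norm v \<le> p"
    with False order_trans[OF norm_ge_zero \<open>norm v \<le> p\<close>] have "p = 0" by simp
    with \<open>norm v \<le> p\<close> have "v = 0" by simp
    with \<open>p = 0\<close> show "psd (herm p v)"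
      by (simp add: psd_def sum_2 matrix_vector_mult_def herm_components)
  qed
qed

text \<open>Existence and uniqueness together make the \<open>THE\<close> in \<open>msqrt\<close>
  meaningful. The root has the same Bloch axis as A, and its eigenvalues a, b are the square roots
  of those of A.\<close>

lemma psd_sqrt_ex1:
  fixes A :: "complex^2^2"
  assumes "psd A"
  shows "\<exists>!S. psd S \<and> S ** S = A"
proof -
  obtain P V where A: "A = herm P V"
    using hermitian_imp_herm assms psd_def by metis
  have PV: "norm V \<le> P" using assms by (simp add: A psd_herm_iff)
  define a b where "a = sqrt (P + norm V)" and "b = sqrt (P - norm V)"
  have a2: "a\<^sup>2 = P + norm V" and b2: "b\<^sup>2 = P - norm V" and ab: "0 \<le> b" "b \<le> a"
    using PV order_trans[OF norm_ge_zero PV] by (auto simp: a_def b_def)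
  define p where "p = (a + b) / 2"
  \<comment> \<open>If a + b = 0, division by zero yields v = 0, which is correct because then V =
    0.\<close>
  define v where "v = (1 / (a + b)) *\<^sub>R V"
  have nv: "norm v = (a - b) / 2"
  proof (cases "a + b = 0")
    case True
    with ab show ?thesis by (auto simp: v_def)
  next
    case False
    have "(a - b) * (a + b) = 2 * norm V"
      using a2 b2 by (simp add: power2_eq_square algebra_simps)
    with False ab show ?thesis by (simp add: v_def field_simps)
  qed
  have sq: "herm p v ** herm p v = A"
  proof -
    have "p\<^sup>2 + (norm v)\<^sup>2 = (a\<^sup>2 + b\<^sup>2) / 2"
      by (simp add: p_def nv power2_eq_square field_simps)
    then have "p\<^sup>2 + (norm v)\<^sup>2 = P" by (simp add: a2 b2)
    moreover have "(2 * p) *\<^sub>R v = V"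
    proof (cases "a + b = 0")
      case True
      with ab have "a = 0" "b = 0" by auto
      with a2 b2 have "V = 0" by simp
      then show ?thesis by (simp add: v_def)
    qed (simp add: v_def p_def)
    ultimately show ?thesis by (simp add: herm_square A)
  qed
  show ?thesis
  proof (rule ex1I[of _ "herm p v"])
    show "psd (herm p v) \<and> herm p v ** herm p v = A"
      using sq ab by (simp add: psd_herm_iff nv p_def)
  next
    fix S assume S: "psd S \<and> S ** S = A"
    then obtain q w where S': "S = herm q w"
      using hermitian_imp_herm psd_def by metis
    have qw: "norm w \<le> q" using S by (simp add: S' psd_herm_iff)
    have q0: "0 \<le> q" using order_trans[OF norm_ge_zero qw] .
    have e: "q\<^sup>2 + (norm w)\<^sup>2 = P" "(2 * q) *\<^sub>R w = V"
      using S by (auto simp: S' A herm_square herm_inject)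
    have nV: "norm V = 2 * q * norm w" using q0 by (simp flip: e(2))
    \<comment> \<open>The eigenvalues of any positive root are forced to be a and b, which
      determines q and then w.\<close>
    have "a = q + norm w"
      unfolding a_def using q0
      by (intro real_sqrt_unique) (auto simp: nV power2_eq_square algebra_simps simp flip: e(1))
    moreover have "b = q - norm w"
      unfolding b_def using qw norm_ge_zero[of w]
      by (intro real_sqrt_unique) (auto simp: nV power2_eq_square algebra_simps simp flip: e(1))
    ultimately have "p = q" and abq: "a + b = 2 * q" by (auto simp: p_def)
    moreover have "v = w"
    proof (cases "q = 0")
      case True
      with qw have "w = 0" by simp
      with e(2) show ?thesis by (auto simp: v_def)
    qed (simp add: v_def abq flip: e(2))
    ultimately show "S = herm p v" by (simp add: S')
  qed
qed

lemma msqrt_psd: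
  fixes A :: "complex^2^2"
  assumes "psd A"
  shows "psd (msqrt A)" and "msqrt A ** msqrt A = A"
  using theI'[OF psd_sqrt_ex1[OF assms]] by (auto simp: msqrt_def)

lemma psd_conjugate:
  fixes S B :: "complex^'n^'n"
  assumes S: "dagger S = S" and B: "psd B"
  shows "psd (S ** B ** S)"
proof -
  have h: "cnj (S $ j $ i) = S $ i $ j" for i j
    using arg_cong[OF S, of "\<lambda>A. A $ i $ j"] by (simp add: dagger_def)
  have adj: "(\<Sum>i\<in>UNIV. cnj (v $ i) * (S *v w) $ i) = (\<Sum>i\<in>UNIV. cnj ((S *v v) $ i) * w $ i)"
    for v w :: "complex^'n"
  proof -
    have "(\<Sum>i\<in>UNIV. cnj (v $ i) * (S *v w) $ i)
        = (\<Sum>i\<in>UNIV. \<Sum>j\<in>UNIV. cnj (v $ i) * S $ i $ j * w $ j)"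
      by (simp add: matrix_vector_mult_def sum_distrib_left mult.assoc)
    also have "\<dots> = (\<Sum>j\<in>UNIV. \<Sum>i\<in>UNIV. cnj (v $ i) * S $ i $ j * w $ j)"
      by (rule sum.swap)
    also have "\<dots> = (\<Sum>i\<in>UNIV. cnj ((S *v v) $ i) * w $ i)"
      by (simp add: matrix_vector_mult_def sum_distrib_right sum_distrib_left h mult_ac)
    finally show ?thesis .
  qed
  have dm: "dagger (X ** Y) = dagger Y ** dagger X" for X Y :: "complex^'n^'n"
    by (simp add: dagger_def matrix_matrix_mult_def vec_eq_iff mult.commute)
  have "dagger (S ** B ** S) = S ** B ** S"
    using B by (simp add: dm S psd_def matrix_mul_assoc)
  moreover have "0 \<le> Re (\<Sum>i\<in>UNIV. cnj (v $ i) * ((S ** B ** S) *v v) $ i)" for v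
  proof -
    have "(S ** B ** S) *v v = S *v (B *v (S *v v))"
      by (simp add: matrix_vector_mul_assoc matrix_mul_assoc)
    then show ?thesis using B by (simp add: adj psd_def)
  qed
  ultimately show ?thesis by (simp add: psd_def)
qed

text \<open>If the root has eigenvalues x, y >= 0, then (x + y)^2 = (x^2 + y^2) + 2 x y, and x y is
  the root of the determinant of A.\<close>

lemma trace_msqrt_power2:
  fixes A :: "complex^2^2"
  assumes "psd A"
  shows "(Re (trace (msqrt A)))\<^sup>2 = Re (trace A) + 2 * sqrt (Re (det A))"
proof -
  obtain p v where R: "msqrt A = herm p v"
    using hermitian_imp_herm msqrt_psd(1)[OF assms] psd_def by metis
  have pv: "norm v \<le> p" using msqrt_psd(1)[OF assms] by (simp add: R psd_herm_iff)
  then have d: "0 \<le> p\<^sup>2 - (norm v)\<^sup>2" by (simp add: power_mono)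
  have A: "A = herm p v ** herm p v" using msqrt_psd(2)[OF assms] by (simp add: R)
  have "Re (trace A) = 2 * (p\<^sup>2 + (norm v)\<^sup>2)"
    by (simp add: A trace_herm_mult power2_eq_square dot_square_norm)
  moreover have "Re (det A) = (p\<^sup>2 - (norm v)\<^sup>2)\<^sup>2"
    by (simp add: A det_mul det_herm power2_eq_square)
  ultimately show ?thesis
    using d by (simp add: R trace_herm power_mult_distrib)
qed

text \<open>Only trace and determinant of the inner product matrix are needed. Cyclicity of the
  trace and multiplicativity of the determinant express both without computing the root of the first
  state.\<close>

theorem fidelity_bloch:
  assumes t: "norm t \<le> 1" and r: "norm r \<le> 1"
  shows "fidelity (bloch_matrix t) (bloch_matrix r)
     = (1 + t \<bullet> r + sqrt ((1 - (norm t)\<^sup>2) * (1 - (norm r)\<^sup>2))) / 2"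
proof -
  let ?T = "bloch_matrix t" and ?R = "bloch_matrix r"
  let ?S = "msqrt ?T" and ?A = "msqrt ?T ** ?R ** msqrt ?T"
  have pT: "psd ?T" and pR: "psd ?R"
    using t r by (simp_all add: bloch_matrix_eq_herm psd_herm_iff)
  note S = msqrt_psd[OF pT]
  have pA: "psd ?A"
    using psd_conjugate S(1) pR psd_def by metis
  have "trace ?A = trace (?T ** ?R)"
    by (metis S(2) trace_mul_sym matrix_mul_assoc)
  also have "\<dots> = of_real ((1 + t \<bullet> r) / 2)"
    by (simp add: bloch_matrix_eq_herm trace_herm_mult add_divide_distrib)
  finally have trA: "trace ?A = of_real ((1 + t \<bullet> r) / 2)" .
  have "det ?A = det ?T * det ?R"
    using arg_cong[OF S(2), of det] by (simp add: det_mul mult_ac)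
  also have "\<dots> = of_real (((1 - (norm t)\<^sup>2) * (1 - (norm r)\<^sup>2)) / 16)"
    by (simp add: bloch_matrix_eq_herm det_herm field_simps power_divide)
  finally have detA: "det ?A = of_real (((1 - (norm t)\<^sup>2) * (1 - (norm r)\<^sup>2)) / 16)" .
  have "sqrt 16 = (4::real)" by (rule real_sqrt_unique) auto
  then show ?thesis
    unfolding fidelity_def trace_msqrt_power2[OF pA] trA detA
    by (simp add: real_sqrt_divide add_divide_distrib)
qed

lemma pure_state_bloch:
  assumes t: "norm t = 1"
  shows "pure_state (bloch_matrix t)"
proof -
  have n: "(t $ 1)\<^sup>2 + (t $ 2)\<^sup>2 + (t $ 3)\<^sup>2 = 1" using t norm_power2_3[of t] by simp
  \<comment> \<open>The vector is the normalized first column of the matrix. That column vanishes at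
    the south pole, which is treated separately.\<close>
  have "\<exists>\<psi>::complex^2. norm \<psi> = 1 \<and> bloch_matrix t = (\<chi> i j. \<psi> $ i * cnj (\<psi> $ j))"
  proof (cases "t $ 3 = -1")
    case True
    with n have "t $ 1 = 0" "t $ 2 = 0"
      by (simp_all add: sum_power2_eq_zero_iff)
    with True show ?thesis
      by (intro exI[of _ "vector [0, 1]"])
         (simp add: vec_eq_iff forall_2 bloch_matrix_components complex_eq_iff norm_vec_def
           L2_set_def sum_2)
  next
    case False
    have "\<bar>t $ 3\<bar> \<le> 1" using t component_le_norm_cart[of t 3] by simp
    with False have z: "0 < 1 + t $ 3" by auto
    define a where "a = sqrt ((1 + t $ 3) / 2)"
    have a: "a > 0" and a2: "a * a = (1 + t $ 3) / 2" using z by (auto simp: a_def)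
    have xy: "(t $ 1)\<^sup>2 + (t $ 2)\<^sup>2 = (1 - t $ 3) * (2 * (a * a))"
      using n by (simp add: a2 power2_eq_square algebra_simps)
    define \<psi> :: "complex^2" where "\<psi> = vector [of_real a, Complex (t $ 1 / (2*a)) (t $ 2 / (2*a))]"
    have e: "((t $ 1) / (2*a))\<^sup>2 + ((t $ 2) / (2*a))\<^sup>2 = (1 - t $ 3) / 2"
    proof -
      have "((t $ 1) / (2*a))\<^sup>2 + ((t $ 2) / (2*a))\<^sup>2 = ((t $ 1)\<^sup>2 + (t $ 2)\<^sup>2) / (4 * (a * a))"
        using a by (simp add: power2_eq_square field_simps)
      then show ?thesis using a by (simp add: xy)
    qed
    have "norm \<psi> = 1"
      using a2 e by (simp add: \<psi>_def norm_vec_def L2_set_def sum_2 cmod_def power2_eq_square add_divide_distrib diff_divide_distrib)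
    moreover have "bloch_matrix t = (\<chi> i j. \<psi> $ i * cnj (\<psi> $ j))"
      using a a2 e
      by (simp add: \<psi>_def vec_eq_iff forall_2 bloch_matrix_components complex_eq_iff power2_eq_square)
    ultimately show ?thesis by blast
  qed
  moreover have "qubit_state (bloch_matrix t)"
    using t unfolding qubit_state_iff_bloch by (intro exI[of _ t]) simp
  ultimately show ?thesis by (simp add: pure_state_def)
qed

section \<open>Maximum likelihood\<close>

text \<open>The convention \<open>0 log 0 = 0\<close> becomes \<open>0\<^sup>0 = 1\<close>, whereas \<open>0 powr 0 = 0\<close>.\<close>

definition wpow :: "real \<Rightarrow> real \<Rightarrow> real" where
  "wpow x p = (if p = 0 then 1 else x powr p)"

text \<open>The exponential of one coordinate's share of the log-likelihood. Being real-valued, it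
  avoids -\<infinity> and stays continuous up to the boundary of the ball.\<close>

definition coord_likelihood :: "real \<Rightarrow> real \<Rightarrow> real" where
  "coord_likelihood c x = wpow ((1 + x) / 2) ((1 + c) / 2) * wpow ((1 - x) / 2) ((1 - c) / 2)"

definition likelihood :: "real^3 \<Rightarrow> real^3 \<Rightarrow> real" where
  "likelihood c r = (\<Prod>k\<in>UNIV. coord_likelihood (c $ k) (r $ k))"

lemma wpow_nonneg: "0 \<le> wpow x p"
  by (simp add: wpow_def)

lemma coord_likelihood_nonneg: "0 \<le> coord_likelihood c x"
  by (simp add: coord_likelihood_def wpow_nonneg)

lemma likelihood_nonneg: "0 \<le> likelihood c r"
  by (simp add: likelihood_def coord_likelihood_nonneg prod_nonneg)

lemma elog_wpow: "0 \<le> x \<Longrightarrow> 0 \<le> p \<Longrightarrow> elog (wpow x p) = ereal p * elog x"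
  by (auto simp: elog_def wpow_def ln_powr)

lemma elog_mult: "0 \<le> x \<Longrightarrow> 0 \<le> y \<Longrightarrow> elog (x * y) = elog x + elog y"
  by (auto simp: elog_def ln_mult zero_less_mult_iff)

lemma norm_le_1_component: "norm (r::real^'n) \<le> 1 \<Longrightarrow> - 1 \<le> r $ k \<and> r $ k \<le> 1"
  using component_le_norm_cart[of r k] by auto

lemma elog_prod:
  "finite A \<Longrightarrow> (\<And>k. k \<in> A \<Longrightarrow> 0 \<le> f k) \<Longrightarrow> elog (\<Prod>k\<in>A. f k) = (\<Sum>k\<in>A. elog (f k))"
proof (induction A rule: finite_induct)
  case (insert k A)
  then have "elog (f k * (\<Prod>k\<in>A. f k)) = elog (f k) + elog (\<Prod>k\<in>A. f k)"
    by (intro elog_mult prod_nonneg) auto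
  with insert show ?case by simp
qed (simp add: elog_def)

lemma elog_le_iff: "0 \<le> x \<Longrightarrow> 0 \<le> y \<Longrightarrow> elog x \<le> elog y \<longleftrightarrow> x \<le> y"
  by (auto simp: elog_def)

lemma log_likelihood_eq:
  assumes P: "\<And>k. P 1 k = (1 + c $ k) / 2" "\<And>k. P (-1) k = (1 - c $ k) / 2"
    and c: "\<And>k. \<bar>c $ k\<bar> \<le> 1" and r: "norm r \<le> 1"
  shows "log_likelihood P r = elog (likelihood c r)"
proof -
  have "(\<Sum>a\<in>{1, -1}. ereal (P a k) * elog ((1 + a * r $ k) / 2))
      = elog (coord_likelihood (c $ k) (r $ k))" for k
    using c[of k] norm_le_1_component[OF r, of k]
    by (simp add: P coord_likelihood_def elog_mult wpow_nonneg elog_wpow)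
  then show ?thesis
    unfolding log_likelihood_def likelihood_def
    by (simp only: elog_prod[OF finite coord_likelihood_nonneg])
qed

lemma is_arg_max_log_likelihood_iff:
  assumes "\<And>k. P 1 k = (1 + c $ k) / 2" "\<And>k. P (-1) k = (1 - c $ k) / 2"
    and "\<And>k. \<bar>c $ k\<bar> \<le> 1"
  shows "is_arg_max (log_likelihood P) (\<lambda>r. r \<in> {r. norm r \<le> 1}) r \<longleftrightarrow>
    norm r \<le> 1 \<and> (\<forall>y. norm y \<le> 1 \<longrightarrow> likelihood c y \<le> likelihood c r)"
  by (auto simp: is_arg_max_def log_likelihood_eq[OF assms] not_less elog_le_iff likelihood_nonneg
      cong: conj_cong)

text \<open>Continuity on the compact ball. Without existence nothing could be said about the choice
  made by \<open>arg_max_on\<close>.\<close>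

lemma likelihood_attains_max:
  assumes c: "\<And>k. \<bar>c $ k\<bar> \<le> 1"
  shows "\<exists>r. norm r \<le> 1 \<and> (\<forall>y. norm y \<le> 1 \<longrightarrow> likelihood c y \<le> likelihood c r)"
proof -
  have w: "continuous_on S (\<lambda>r. wpow (g r) p)"
    if "continuous_on S g" "0 \<le> p" "\<And>r. r \<in> S \<Longrightarrow> 0 \<le> g r" for S p and g :: "real^3 \<Rightarrow> real"
  proof (cases "p = 0")
    case False
    with that show ?thesis
      by (simp add: wpow_def) (intro continuous_on_powr' continuous_on_const, auto)
  qed (simp add: wpow_def)
  have "continuous_on (cball 0 1) (likelihood c)"
    unfolding likelihood_def coord_likelihood_def
  proof (intro continuous_on_prod continuous_on_mult w)
    fix k and r :: "real^3" assume "r \<in> cball 0 1"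
    then show "0 \<le> (1 + r $ k) / 2" "0 \<le> (1 - r $ k) / 2"
      using norm_le_1_component[of r k] by auto
  next
    fix k show "0 \<le> (1 + c $ k) / 2" "0 \<le> (1 - c $ k) / 2"
      using c[of k] by auto
  qed (auto intro!: continuous_intros)
  from continuous_attains_sup[OF _ _ this] show ?thesis by auto
qed

text \<open>By \<open>ln u < u - 1\<close> the logarithm grows by more than \<open>(y - x) (c - y) / (1 - y\<^sup>2) \<ge> 0\<close>.\<close>

lemma coord_likelihood_less:
  assumes c: "\<bar>c\<bar> \<le> 1" and x: "\<bar>x\<bar> \<le> 1"
    and pos: "0 < coord_likelihood c x"
    and xy: "x < y \<and> y \<le> c \<or> c \<le> y \<and> y < x"
  shows "coord_likelihood c x < coord_likelihood c y"
proof (cases "\<bar>c\<bar> = 1")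
  case True
  then consider "c = 1" | "c = -1" by linarith
  then show ?thesis
    using xy x by cases (auto simp: coord_likelihood_def wpow_def)
next
  case False
  with c have c': "\<bar>c\<bar> < 1" by simp
  \<comment> \<open>At an endpoint one factor is 0 raised to a positive exponent, contradicting
    positivity.\<close>
  have x': "\<bar>x\<bar> < 1"
    using pos x c' by (cases "x = 1 \<or> x = -1") (auto simp: coord_likelihood_def wpow_def split: if_splits)
  have y': "\<bar>y\<bar> < 1" using x' c' xy by auto
  let ?h = "\<lambda>z. (1 + c) / 2 * ln ((1 + z) / 2) + (1 - c) / 2 * ln ((1 - z) / 2)"
  have L: "coord_likelihood c z = exp (?h z)" if "\<bar>z\<bar> < 1" for z
    using that c' by (auto simp: coord_likelihood_def wpow_def powr_def exp_add)
  have l: "ln v - ln w < v / w - 1" if "0 < v" "0 < w" "v \<noteq> w" for v w :: real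
    using that ln_div[of v w] ln_le_minus_one[of "v / w"] ln_eq_minus_one[of "v / w"]
    by (auto simp: order.strict_iff_order)
  have "?h x - ?h y = (1 + c) / 2 * (ln ((1 + x) / 2) - ln ((1 + y) / 2))
      + (1 - c) / 2 * (ln ((1 - x) / 2) - ln ((1 - y) / 2))"
    by (simp add: algebra_simps)
  also have "\<dots> < (1 + c) / 2 * (((1 + x) / 2) / ((1 + y) / 2) - 1)
      + (1 - c) / 2 * (((1 - x) / 2) / ((1 - y) / 2) - 1)"
    using c' x' y' xy by (intro add_strict_mono mult_strict_left_mono l) auto
  also have "\<dots> = (x - y) * (c - y) / ((1 + y) * (1 - y))"
  proof -
    have "1 + y \<noteq> 0" "1 - y \<noteq> 0" using y' by auto
    then show ?thesis by (simp add: divide_simps) (simp add: algebra_simps)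
  qed
  also have "\<dots> \<le> 0"
    using xy y' by (intro divide_nonpos_pos) (auto simp: mult_le_0_iff)
  finally show ?thesis using x' y' by (simp add: L)
qed

lemma likelihood_component_less:
  assumes pos: "0 < likelihood c r"
    and "coord_likelihood (c $ k) (r $ k) < coord_likelihood (c $ k) y"
  shows "likelihood c r < likelihood c (\<chi> i. if i = k then y else r $ i)"
proof -
  let ?f = "\<lambda>i. coord_likelihood (c $ i) (r $ i)"
  let ?g = "\<lambda>i. coord_likelihood (c $ i) (if i = k then y else r $ i)"
  have "likelihood c r = ?f k * prod ?f (UNIV - {k})"
    unfolding likelihood_def by (simp add: prod.remove)
  moreover have "0 < prod ?f (UNIV - {k})"
    using pos coord_likelihood_nonneg
    by (intro prod_pos) (auto simp: likelihood_def order.strict_iff_order)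
  moreover have "likelihood c (\<chi> i. if i = k then y else r $ i) = ?g k * prod ?g (UNIV - {k})"
    unfolding likelihood_def by (simp add: prod.remove[of UNIV k])
  moreover have "prod ?g (UNIV - {k}) = prod ?f (UNIV - {k})"
    by (intro prod.cong) auto
  ultimately show ?thesis using assms(2) by simp
qed

lemma coord_likelihood_0_pos: "0 < coord_likelihood c 0"
  by (simp add: coord_likelihood_def wpow_def)

section \<open>Location of a maximizer of the likelihood on the unit ball\<close>

context
  fixes c r :: "real^3"
  assumes c: "\<And>k. \<bar>c $ k\<bar> \<le> 1" and r: "norm r \<le> 1"
    and max: "\<And>y. norm y \<le> 1 \<Longrightarrow> likelihood c y \<le> likelihood c r"
begin

lemma max_likelihood_no_improvement:
  assumes "r $ k < y \<and> y \<le> c $ k \<or> c $ k \<le> y \<and> y < r $ k"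
  shows "1 < norm (\<chi> i. if i = k then y else r $ i)"
proof (rule ccontr)
  \<comment> \<open>Comparison with the origin makes the maximum positive, so no factor vanishes
    there and the strict one-coordinate comparison applies.\<close>
  have "0 < likelihood c 0"
    by (simp add: likelihood_def prod_pos coord_likelihood_0_pos)
  with max[of 0] have pos: "0 < likelihood c r" by simp
  then have "coord_likelihood (c $ k) (r $ k) \<noteq> 0"
    by (auto simp: likelihood_def prod_zero_iff order.strict_iff_order)
  then have "coord_likelihood (c $ k) (r $ k) < coord_likelihood (c $ k) y"
    using norm_le_1_component[OF r, of k] assms c
    by (intro coord_likelihood_less) (auto simp: order.strict_iff_order coord_likelihood_nonneg)
  from likelihood_component_less[OF pos this] max
  show "\<not> 1 < norm (\<chi> i. if i = k then y else r $ i) \<Longrightarrow> False"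
    by (metis linorder_not_less)
qed

lemma max_likelihood_between: "0 \<le> r $ k \<and> r $ k \<le> c $ k \<or> c $ k \<le> r $ k \<and> r $ k \<le> 0"
proof (rule ccontr)
  assume n: "\<not> ?thesis"
  have shrink: "norm (\<chi> i. if i = k then y else r $ i) \<le> 1" if "\<bar>y\<bar> \<le> \<bar>r $ k\<bar>" for y
  proof -
    have "norm (\<chi> i. if i = k then y else r $ i) \<le> norm r"
      using that by (intro norm_le_componentwise_cart) auto
    with r show ?thesis by simp
  qed
  \<comment> \<open>If \<open>r $ k\<close> overshoots \<open>c $ k\<close>, it moves back to
    \<open>c $ k\<close>; if it has the wrong sign, it moves to 0. Neither move leaves the
    ball.\<close>
  define y where "y = (if 0 \<le> r $ k * c $ k then c $ k else 0)"
  have y: "r $ k < y \<and> y \<le> c $ k \<or> c $ k \<le> y \<and> y < r $ k" "\<bar>y\<bar> \<le> \<bar>r $ k\<bar>"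
    using n by (auto simp: y_def zero_le_mult_iff not_le split: if_splits)
  from max_likelihood_no_improvement[OF y(1)] shrink[OF y(2)] show False by simp
qed

lemma max_likelihood_norm:
  assumes "1 < norm c"
  shows "norm r = 1"
proof (rule ccontr)
  assume "norm r \<noteq> 1"
  with r have r1: "norm r < 1" by simp
  with assms have "r \<noteq> c" by auto
  then obtain k where k: "r $ k \<noteq> c $ k" by (auto simp: vec_eq_iff)
  \<comment> \<open>The bound 1 prevents passing \<open>c $ k\<close>; the other bound keeps the
    step within the distance 1 - |r| to the sphere.\<close>
  define s where "s = min 1 ((1 - norm r) / \<bar>c $ k - r $ k\<bar>)"
  have s: "0 < s" "s \<le> 1" using k r1 by (auto simp: s_def)
  have s': "s * \<bar>c $ k - r $ k\<bar> \<le> 1 - norm r"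
    using k r1 by (auto simp: s_def min_def field_simps)
  define y where "y = r $ k + s * (c $ k - r $ k)"
  have 1: "r $ k < y \<and> y \<le> c $ k \<or> c $ k \<le> y \<and> y < r $ k"
  proof (cases "r $ k < c $ k")
    case True
    then have "s * (c $ k - r $ k) \<le> 1 * (c $ k - r $ k)" using s by (intro mult_right_mono) auto
    moreover have "0 < s * (c $ k - r $ k)" using True s by simp
    ultimately show ?thesis by (simp add: y_def)
  next
    case False
    then have "s * (r $ k - c $ k) \<le> 1 * (r $ k - c $ k)" using s by (intro mult_right_mono) auto
    moreover have "0 < s * (r $ k - c $ k)" using False k s by simp
    ultimately show ?thesis by (simp add: y_def algebra_simps)
  qed
  have "(\<chi> i. if i = k then y else r $ i) = r + (s * (c $ k - r $ k)) *\<^sub>R axis k 1"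
    by (simp add: vec_eq_iff y_def axis_def)
  then have "norm (\<chi> i. if i = k then y else r $ i) \<le> norm r + s * \<bar>c $ k - r $ k\<bar>"
    using norm_triangle_ineq[of r "(s * (c $ k - r $ k)) *\<^sub>R axis k 1"] s
    by (simp add: abs_mult)
  with s' max_likelihood_no_improvement[OF 1] show False by simp
qed

end

section \<open>The fidelity bound\<close>

text \<open>Cauchy-Schwarz for the parts of e and t orthogonal to n; the former has length at most
  sin \<epsilon>.\<close>

lemma inner_close_directions:
  fixes n e t :: "'a::real_inner"
  assumes n: "norm n = 1" and e: "norm e = 1" and ne: "cos \<epsilon> \<le> n \<bullet> e"
    and \<epsilon>: "0 \<le> \<epsilon>" "\<epsilon> \<le> pi / 2"
  shows "\<bar>e \<bullet> t - (n \<bullet> e) * (n \<bullet> t)\<bar> \<le> sin \<epsilon> * sqrt ((norm t)\<^sup>2 - (n \<bullet> t)\<^sup>2)"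
proof -
  have nn: "n \<bullet> n = 1" and ee: "e \<bullet> e = 1"
    using n e by (simp_all add: dot_square_norm)
  have c0: "0 \<le> cos \<epsilon>" and s0: "0 \<le> sin \<epsilon>"
    using \<epsilon> by (auto intro: cos_ge_zero sin_ge_zero)
  let ?u = "e - (n \<bullet> e) *\<^sub>R n" and ?w = "t - (n \<bullet> t) *\<^sub>R n"
  have u: "(norm ?u)\<^sup>2 = 1 - (n \<bullet> e)\<^sup>2"
    unfolding power2_norm_eq_inner
    by (simp add: inner_diff inner_commute[of e n] nn ee power2_eq_square)
  have w: "(norm ?w)\<^sup>2 = (norm t)\<^sup>2 - (n \<bullet> t)\<^sup>2"
    unfolding power2_norm_eq_inner
    by (simp add: inner_diff inner_commute[of t n] nn power2_eq_square)
  have "(norm ?u)\<^sup>2 \<le> (sin \<epsilon>)\<^sup>2"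
    using power_mono[OF ne c0, of 2] by (simp add: u sin_squared_eq)
  then have "norm ?u \<le> sin \<epsilon>" using s0 by (simp add: power2_le_iff_abs_le)
  moreover have "norm ?w = sqrt ((norm t)\<^sup>2 - (n \<bullet> t)\<^sup>2)"
    by (simp flip: w)
  moreover have "e \<bullet> t - (n \<bullet> e) * (n \<bullet> t) = ?u \<bullet> ?w"
    by (simp add: inner_diff nn inner_commute[of e n])
  ultimately show ?thesis
    using Cauchy_Schwarz_ineq2[of ?u ?w] by (smt (verit) mult_right_mono norm_ge_zero)
qed

text \<open>By AM-GM, \<open>\<surd>2 |x| \<surd>(q\<^sup>2 - x\<^sup>2) \<le> (2 x\<^sup>2 + (q\<^sup>2 - x\<^sup>2)) / 2\<close>, which sums to \<open>2 q\<^sup>2\<close> over the three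
  components; equality holds for \<open>x\<^sup>2 = q\<^sup>2 / 3\<close>.\<close>

lemma inner_ge_of_components:
  fixes a b :: "real^3"
  assumes s: "0 \<le> s"
    and ab: "\<And>k. (a $ k)\<^sup>2 * C - \<bar>a $ k\<bar> * sqrt ((norm a)\<^sup>2 - (a $ k)\<^sup>2) * s \<le> a $ k * b $ k"
  shows "(norm a)\<^sup>2 * (C - sqrt 2 * s) \<le> a \<bullet> b"
proof -
  let ?q = "norm a" and ?g = "\<lambda>k. \<bar>a $ k\<bar> * sqrt ((norm a)\<^sup>2 - (a $ k)\<^sup>2)"
  have *: "?g k \<le> sqrt 2 * ((a $ k)\<^sup>2 + ?q\<^sup>2) / 4" for k
  proof -
    have "(a $ k)\<^sup>2 \<le> ?q\<^sup>2" using power_mono[OF component_le_norm_cart[of a k], of 2] by simp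
    then have "(sqrt ((norm a)\<^sup>2 - (a $ k)\<^sup>2))\<^sup>2 = ?q\<^sup>2 - (a $ k)\<^sup>2" by simp
    moreover have "0 \<le> (sqrt 2 * \<bar>a $ k\<bar> - sqrt ((norm a)\<^sup>2 - (a $ k)\<^sup>2))\<^sup>2" by simp
    ultimately have "2 * sqrt 2 * ?g k \<le> (a $ k)\<^sup>2 + ?q\<^sup>2"
      by (simp add: power2_diff power_mult_distrib algebra_simps)
    then have "sqrt 2 * (2 * sqrt 2 * ?g k) \<le> sqrt 2 * ((a $ k)\<^sup>2 + ?q\<^sup>2)"
      by (intro mult_left_mono) auto
    moreover have "sqrt 2 * (2 * sqrt 2 * ?g k) = 4 * ?g k"
      by simp
    ultimately show ?thesis by linarith
  qed
  have "?g 1 + ?g 2 + ?g 3 \<le> sqrt 2 * ((a $ 1)\<^sup>2 + (a $ 2)\<^sup>2 + (a $ 3)\<^sup>2 + 3 * ?q\<^sup>2) / 4"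
    using *[of 1] *[of 2] *[of 3] by (simp add: algebra_simps)
  also have "\<dots> = sqrt 2 * ?q\<^sup>2" by (simp flip: norm_power2_3)
  finally have "(?g 1 + ?g 2 + ?g 3) * s \<le> sqrt 2 * ?q\<^sup>2 * s"
    using s by (rule mult_right_mono)
  moreover have "?q\<^sup>2 * C - (?g 1 + ?g 2 + ?g 3) * s \<le> a \<bullet> b"
    using ab[of 1] ab[of 2] ab[of 3]
    by (simp add: norm_power2_3[of a] inner_vec_def sum_3 algebra_simps)
  ultimately show ?thesis by (simp add: algebra_simps)
qed

text \<open>The previous estimate times |n \<bullet> t|, with n \<bullet> e lowered to cos
  \<epsilon>. The parameter q is later taken to be |t|, |c| or 1.\<close>

lemma inner_prod_close_directions:
  fixes n e t :: "'a::real_inner"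
  assumes "norm n = 1" "norm e = 1" "cos \<epsilon> \<le> n \<bullet> e" "0 \<le> \<epsilon>" "\<epsilon> \<le> pi / 2"
    and q: "norm t \<le> q"
  shows "(n \<bullet> t)\<^sup>2 * cos \<epsilon> - \<bar>n \<bullet> t\<bar> * sqrt (q\<^sup>2 - (n \<bullet> t)\<^sup>2) * sin \<epsilon> \<le> (n \<bullet> t) * (e \<bullet> t)"
proof -
  let ?x = "n \<bullet> t" and ?y = "e \<bullet> t"
  have s: "0 \<le> sin \<epsilon>" using assms by (auto intro: sin_ge_zero)
  have "(norm t)\<^sup>2 \<le> q\<^sup>2" using q by (simp add: power_mono)
  then have "sin \<epsilon> * sqrt ((norm t)\<^sup>2 - ?x\<^sup>2) \<le> sin \<epsilon> * sqrt (q\<^sup>2 - ?x\<^sup>2)"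
    using s by (intro mult_left_mono) auto
  with inner_close_directions[OF assms(1-5), of t]
  have "\<bar>?y - (n \<bullet> e) * ?x\<bar> \<le> sin \<epsilon> * sqrt (q\<^sup>2 - ?x\<^sup>2)" by linarith
  then have "\<bar>?x\<bar> * \<bar>?y - (n \<bullet> e) * ?x\<bar> \<le> \<bar>?x\<bar> * (sin \<epsilon> * sqrt (q\<^sup>2 - ?x\<^sup>2))"
    by (rule mult_left_mono) simp
  then have "- (\<bar>?x\<bar> * (sin \<epsilon> * sqrt (q\<^sup>2 - ?x\<^sup>2))) \<le> ?x * (?y - (n \<bullet> e) * ?x)"
    by (simp add: abs_le_iff flip: abs_mult)
  moreover have "?x\<^sup>2 * cos \<epsilon> \<le> ?x\<^sup>2 * (n \<bullet> e)"
    using assms(3) by (rule mult_left_mono) simp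
  ultimately show ?thesis by (simp add: power2_eq_square algebra_simps)
qed

section \<open>Lower bounds for a given state and given directions\<close>

context
  fixes \<epsilon> :: real and n :: "3 \<Rightarrow> real^3" and t c :: "real^3"
  assumes \<epsilon>: "0 \<le> \<epsilon>" "\<epsilon> \<le> pi / 2" and n: "directions_within \<epsilon> n" and t: "norm t \<le> 1"
  defines "c \<equiv> \<chi> k. n k \<bullet> t"
begin

lemma correlation_abs_le: "\<bar>c $ k\<bar> \<le> norm t"
  using Cauchy_Schwarz_ineq2[of "n k" t] n by (simp add: c_def directions_within_def)

lemma component_prod_ge:
  assumes "norm t \<le> q"
  shows "(t $ k)\<^sup>2 * cos \<epsilon> - \<bar>t $ k\<bar> * sqrt (q\<^sup>2 - (t $ k)\<^sup>2) * sin \<epsilon> \<le> t $ k * c $ k"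
    and "(c $ k)\<^sup>2 * cos \<epsilon> - \<bar>c $ k\<bar> * sqrt (q\<^sup>2 - (c $ k)\<^sup>2) * sin \<epsilon> \<le> c $ k * t $ k"
  using inner_prod_close_directions[of "axis k 1" "n k" \<epsilon> t q]
    inner_prod_close_directions[of "n k" "axis k 1" \<epsilon> t q] n assms \<epsilon>
  by (simp_all add: directions_within_def inner_axis' inner_axis inner_commute c_def)

lemma sin_nonneg: "0 \<le> sin \<epsilon>"
  using \<epsilon> by (auto intro: sin_ge_zero)

text \<open>Let \<open>a\<close> be the longer of \<open>t\<close> and \<open>c\<close>, and \<open>g\<close> the left-hand side.  The inner product is at
  least \<open>|a|\<^sup>2 g\<close>, the square root at least \<open>1 - |a|\<^sup>2\<close>, and \<open>g \<le> 1\<close>.\<close>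

lemma linear_inversion_bound:
  assumes c1: "norm c \<le> 1"
  shows "cos \<epsilon> - sqrt 2 * sin \<epsilon> \<le> t \<bullet> c + sqrt ((1 - (norm t)\<^sup>2) * (1 - (norm c)\<^sup>2))"
proof -
  let ?g = "cos \<epsilon> - sqrt 2 * sin \<epsilon>"
  have g: "?g \<le> 1" using sin_nonneg cos_le_one[of \<epsilon>] by (smt (verit) mult_nonneg_nonneg real_sqrt_ge_0_iff)
  have *: "?g \<le> a \<bullet> b + sqrt ((1 - (norm a)\<^sup>2) * (1 - (norm b)\<^sup>2))"
    if ab: "(norm a)\<^sup>2 * ?g \<le> a \<bullet> b" "norm b \<le> norm a" "norm a \<le> 1" for a b :: "real^3"
  proof -
    have a1: "0 \<le> 1 - (norm a)\<^sup>2" using ab(3) by (simp add: power_le_one)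
    have "1 - (norm a)\<^sup>2 \<le> 1 - (norm b)\<^sup>2" using ab(2) by (simp add: power_mono)
    then have "(1 - (norm a)\<^sup>2) * (1 - (norm a)\<^sup>2) \<le> (1 - (norm a)\<^sup>2) * (1 - (norm b)\<^sup>2)"
      using a1 by (rule mult_left_mono)
    then have "1 - (norm a)\<^sup>2 \<le> sqrt ((1 - (norm a)\<^sup>2) * (1 - (norm b)\<^sup>2))"
      by (intro real_le_rsqrt) (simp add: power2_eq_square)
    moreover have "(1 - (norm a)\<^sup>2) * ?g \<le> 1 - (norm a)\<^sup>2"
      using mult_left_mono[OF g a1] by simp
    ultimately show ?thesis using ab(1) by (simp add: algebra_simps)
  qed
  show ?thesis
  proof (cases "norm c \<le> norm t")
    case True
    have "(norm t)\<^sup>2 * ?g \<le> t \<bullet> c"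
      using component_prod_ge(1)[OF order_refl] sin_nonneg by (rule inner_ge_of_components[rotated])
    with True t show ?thesis by (rule *[rotated])
  next
    case False
    then have "(norm c)\<^sup>2 * ?g \<le> c \<bullet> t"
      using component_prod_ge(2)[of "norm c"] sin_nonneg by (intro inner_ge_of_components) auto
    with *[of c t] False c1 show ?thesis by (simp add: inner_commute mult.commute)
  qed
qed

text \<open>The lower bound on \<open>\<bar>t $ k\<bar>\<close> in terms of \<open>\<bar>c $ k\<bar>\<close> is increasing in \<open>\<bar>c $ k\<bar>\<close>, so it survives
  the replacement of \<open>c\<close> by the shorter \<open>r\<close>.\<close>

lemma maximum_likelihood_bound:
  assumes r: "norm r = 1"
    and rc: "\<And>k. 0 \<le> r $ k \<and> r $ k \<le> c $ k \<or> c $ k \<le> r $ k \<and> r $ k \<le> 0"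
  shows "cos \<epsilon> - sqrt 2 * sin \<epsilon> \<le> t \<bullet> r"
proof -
  have "(r $ k)\<^sup>2 * cos \<epsilon> - \<bar>r $ k\<bar> * sqrt ((norm r)\<^sup>2 - (r $ k)\<^sup>2) * sin \<epsilon> \<le> r $ k * t $ k" for k
  proof (cases "r $ k = 0")
    case False
    \<comment> \<open>The common sign of \<open>r $ k\<close> and \<open>c $ k\<close> is divided
      out, so that only magnitudes are compared.\<close>
    define x y z where "x = \<bar>r $ k\<bar>" and "y = \<bar>c $ k\<bar>" and "z = sgn (r $ k) * t $ k"
    have xy: "0 < x" "x \<le> y" and sg: "sgn (c $ k) = sgn (r $ k)"
      using False rc[of k] by (auto simp: x_def y_def sgn_if)
    have rk: "r $ k = sgn (r $ k) * x" and ck: "c $ k = sgn (r $ k) * y"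
      using sg by (simp_all add: x_def y_def sgn_mult_abs) (metis mult.commute abs_mult_sgn)
    have sq: "(r $ k)\<^sup>2 = x\<^sup>2" "(c $ k)\<^sup>2 = y\<^sup>2" by (simp_all add: x_def y_def)
    have "y\<^sup>2 * cos \<epsilon> - y * sqrt (1 - y\<^sup>2) * sin \<epsilon> \<le> y * z"
      \<comment> \<open>Here q = 1 = |r|, matching the form of the bound required for r.\<close>
      using component_prod_ge(2)[OF t, of k] by (simp add: z_def flip: y_def sq(2)) (simp add: ck mult_ac)
    then have "y * (y * cos \<epsilon> - sqrt (1 - y\<^sup>2) * sin \<epsilon>) \<le> y * z"
      by (simp add: power2_eq_square algebra_simps)
    then have "y * cos \<epsilon> - sqrt (1 - y\<^sup>2) * sin \<epsilon> \<le> z" using xy by simp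
    moreover have "x * cos \<epsilon> \<le> y * cos \<epsilon>"
      using xy \<epsilon> by (intro mult_right_mono cos_ge_zero) auto
    moreover have "sqrt (1 - y\<^sup>2) * sin \<epsilon> \<le> sqrt (1 - x\<^sup>2) * sin \<epsilon>"
      using xy sin_nonneg by (intro mult_right_mono) (auto intro!: power_mono)
    ultimately have "x * cos \<epsilon> - sqrt (1 - x\<^sup>2) * sin \<epsilon> \<le> z" by linarith
    then have "x * (x * cos \<epsilon> - sqrt (1 - x\<^sup>2) * sin \<epsilon>) \<le> x * z"
      using xy by (intro mult_left_mono) auto
    moreover have "r $ k * t $ k = x * z" by (subst rk) (simp add: z_def)
    ultimately show ?thesis
      unfolding x_def[symmetric] r sq
      by (simp add: power2_eq_square algebra_simps)
  qed simp
  from inner_ge_of_components[OF sin_nonneg this] show ?thesis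
    by (simp add: r inner_commute)
qed

lemma fidelity_reconstruction_ge:
  "(1 + cos \<epsilon> - sqrt 2 * sin \<epsilon>) / 2
    \<le> fidelity (bloch_matrix t) (reconstruction (born_data (bloch_matrix t) n))"
proof (cases "norm c \<le> 1")
  case True
  then have "reconstruction (born_data (bloch_matrix t) n) = bloch_matrix c"
    by (simp add: reconstruction_def correlations_born_data c_def)
  with linear_inversion_bound[OF True] show ?thesis
    by (simp add: fidelity_bloch[OF t True] divide_right_mono)
next
  case False
  let ?P = "born_data (bloch_matrix t) n"
  define r where "r = arg_max_on (log_likelihood ?P) {r. norm r \<le> 1}"
  have rec: "reconstruction ?P = bloch_matrix r"
    using False by (simp add: reconstruction_def correlations_born_data c_def r_def)
  have P: "?P 1 k = (1 + c $ k) / 2" "?P (-1) k = (1 - c $ k) / 2" for k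
    by (simp_all add: born_data_def trace_def sum_2 matrix_matrix_mult_def c_def
        bloch_matrix_components inner_vec_def sum_3 dot_pauli_def pauli_def mat_def field_simps)
  have c1: "\<bar>c $ k\<bar> \<le> 1" for k
    using correlation_abs_le[of k] t by simp
  have "\<exists>r. is_arg_max (log_likelihood ?P) (\<lambda>r. r \<in> {r. norm r \<le> 1}) r"
    using likelihood_attains_max[of c, OF c1] unfolding is_arg_max_log_likelihood_iff[of ?P c, OF P c1] .
  then have "is_arg_max (log_likelihood ?P) (\<lambda>r. r \<in> {r. norm r \<le> 1}) r"
    unfolding r_def arg_max_on_def arg_max_def by (rule someI_ex)
  then have r: "norm r \<le> 1" "\<And>y. norm y \<le> 1 \<Longrightarrow> likelihood c y \<le> likelihood c r"
    unfolding is_arg_max_log_likelihood_iff[of ?P c, OF P c1] by auto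
  have r1: "norm r = 1"
    using max_likelihood_norm[of c r] c1 r False by simp
  have "cos \<epsilon> - sqrt 2 * sin \<epsilon> \<le> t \<bullet> r"
    using max_likelihood_between[of c r] c1 r by (intro maximum_likelihood_bound r1) auto
  then show ?thesis
    by (simp add: rec fidelity_bloch[OF t r(1)] r1 divide_right_mono)
qed

end

text \<open>Tightness: the equality case of AM-GM is \<open>t = (1, 1, 1) / \<surd>3\<close>; every \<open>n k\<close> is \<open>e\<^sub>k\<close> rotated
  by \<open>\<epsilon>\<close> away from \<open>t\<close>, so that \<open>c = (cos \<epsilon> - \<surd>2 sin \<epsilon>) t\<close>.\<close>

lemma fidelity_reconstruction_attained:
  assumes g: "0 \<le> cos \<epsilon> - sqrt 2 * sin \<epsilon>" "cos \<epsilon> - sqrt 2 * sin \<epsilon> \<le> 1"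
  shows "\<exists>\<tau> n. pure_state \<tau> \<and> directions_within \<epsilon> n
    \<and> fidelity \<tau> (reconstruction (born_data \<tau> n)) = (1 + cos \<epsilon> - sqrt 2 * sin \<epsilon>) / 2"
proof -
  define t :: "real^3" where "t = (\<chi> i. 1 / sqrt 3)"
  \<comment> \<open>The two equal off-axis entries have squares summing to sin^2 \<epsilon>, so
    \<open>n k\<close> is a unit vector whose k-th entry is exactly cos \<epsilon>.\<close>
  define n :: "3 \<Rightarrow> real^3" where
    "n = (\<lambda>k. \<chi> i. if i = k then cos \<epsilon> else - sin \<epsilon> / sqrt 2)"
  let ?g = "cos \<epsilon> - sqrt 2 * sin \<epsilon>"
  have t: "norm t = 1" by (simp add: t_def norm_vec_def L2_set_def sum_3 power_divide)
  have nn: "norm (n k) = 1" for k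
    using exhaust_3[of k]
    by (auto simp: n_def norm_vec_def L2_set_def sum_3 power_divide)
  have dw: "directions_within \<epsilon> n"
    by (simp add: directions_within_def nn) (simp add: n_def inner_axis)
  have s2: "x / sqrt 2 + x / sqrt 2 = sqrt 2 * x" for x :: real
    by (simp add: field_simps)
  have c: "(\<chi> k. n k \<bullet> t) = ?g *\<^sub>R t"
    using s2[of "sin \<epsilon> / sqrt 3"]
    by (simp add: vec_eq_iff forall_3 inner_vec_def sum_3 n_def t_def diff_divide_distrib mult.commute)
  \<comment> \<open>This selects linear inversion; since |t| = 1, the square root in the fidelity
    vanishes.\<close>
  have c1: "norm (?g *\<^sub>R t) \<le> 1" using g t by simp
  have "fidelity (bloch_matrix t) (reconstruction (born_data (bloch_matrix t) n)) = (1 + ?g) / 2"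
    using c1 t fidelity_bloch[of t "?g *\<^sub>R t"]
    by (simp add: reconstruction_def correlations_born_data c dot_square_norm)
  then show ?thesis
    using pure_state_bloch[OF t] dw by (intro exI[of _ "bloch_matrix t"] exI[of _ n]) simp
qed

theorem mainTheorem1:
  fixes \<epsilon> :: real
  assumes "0 \<le> \<epsilon>" and "\<epsilon> \<le> arccos (sqrt (2/3))"
  defines "f \<equiv> (1 + cos \<epsilon> - sqrt 2 * sin \<epsilon>) / 2"
  shows "(\<forall>\<tau> n. qubit_state \<tau> \<and> directions_within \<epsilon> n
            \<longrightarrow> fidelity \<tau> (reconstruction (born_data \<tau> n)) \<ge> f)
       \<and> (\<exists>\<tau> n. pure_state \<tau> \<and> directions_within \<epsilon> n
            \<and> fidelity \<tau> (reconstruction (born_data \<tau> n)) = f)"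
proof -
  have a: "arccos (sqrt (2/3)) \<le> pi / 2"
    by (intro arccos_le_pi2) (auto simp: real_sqrt_le_1_iff)
  with assms have pi2: "\<epsilon> \<le> pi / 2" by simp
  then have s: "0 \<le> sin \<epsilon>" and c0: "0 \<le> cos \<epsilon>"
    using assms(1) by (auto intro: sin_ge_zero cos_ge_zero)
  have "cos (arccos (sqrt (2/3))) \<le> cos \<epsilon>"
    using assms a by (intro cos_monotone_0_pi_le) auto
  moreover have "cos (arccos (sqrt (2/3))) = sqrt (2/3)"
    by (rule cos_arccos) (simp_all only: real_sqrt_le_1_iff, simp_all add: order_trans[of _ 0])
  ultimately have "sqrt (2/3) \<le> cos \<epsilon>" by simp
  then have "2/3 \<le> (cos \<epsilon>)\<^sup>2" by (rule sqrt_le_D)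
  \<comment> \<open>From cos^2 \<epsilon> >= 2/3 follows 2 sin^2 \<epsilon> <= 2/3, so the bound on
    \<epsilon> makes cos \<epsilon> - sqrt 2 sin \<epsilon> nonnegative, as the tightness example
    assumes.\<close>
  then have "(sqrt 2 * sin \<epsilon>)\<^sup>2 \<le> (cos \<epsilon>)\<^sup>2"
    by (simp add: power_mult_distrib sin_squared_eq)
  then have "sqrt 2 * sin \<epsilon> \<le> cos \<epsilon>" using c0 by (rule power2_le_imp_le)
  moreover have "cos \<epsilon> - sqrt 2 * sin \<epsilon> \<le> 1"
    using s cos_le_one[of \<epsilon>] by (smt (verit) mult_nonneg_nonneg real_sqrt_ge_0_iff)
  ultimately show ?thesis
    using fidelity_reconstruction_attained[of \<epsilon>] fidelity_reconstruction_ge[OF assms(1) pi2]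
    unfolding f_def qubit_state_iff_bloch by auto
qed

end
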